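(* For every element $g\in\mathrm{PSL}_q(2,\mathbb{Z})$ and every matrix $M\in\mathrm{GL}(2,\mathbb{Z}[q^{\pm1}])$ representing $g$, the trace of $M$ is of the form $\pm q^N\,T(q)$ with $N\in\mathbb{Z}$ and $T\in\mathbb{Z}[q]$ a palindromic polynomial with positive integer coefficients.
   Context: Let $\mathrm{U}=\{\pm q^N: N\in\mathbb{Z}\}$, $\mathrm{GL}(2,\mathbb{Z}[q^{\pm1}])$ the $2\times2$ matrices over $\mathbb{Z}[q^{\pm1}]$ with determinant in $\mathrm{U}$, and $\mathrm{PGL}(2,\mathbb{Z}[q^{\pm1}])=\mathrm{GL}(2,\mathbb{Z}[q^{\pm1}])/\{\pm q^N\mathrm{Id}\}$. With $R_q=\begin{pmatrix}q&1\\0&1\end{pmatrix}$, $S_q=\begin{pmatrix}0&-q^{-1}\\1&0\end{pmatrix}$, $\mathrm{PSL}_q(2,\mathbb{Z})$ is the subgroup of $\mathrm{PGL}(2,\mathbb{Z}[q^{\pm1}])$ generated by the classes of $R_q$ and $S_q$. A polynomial $T$ is palindromic if its ordered sequence of coefficients reads the same backward and forward, i.e. $T(q)=q^{n}T(q^{-1})$ for some $n\in\mathbb{Z}$. *)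

theory Defs
  imports
    "HOL-Analysis.Determinants"
    "HOL-Library.Poly_Mapping"
    "HOL-Computational_Algebra.Polynomial"
    "HOL-Algebra.Coset"
    "HOL-Algebra.Generated_Groups"
begin

text \<open>
  The Laurent polynomial ring over the integers is the group ring of the additive group of
  integers: finitely supported functions from exponents to coefficients, with the convolution
  product of \<^theory>\<open>HOL-Library.Poly_Mapping\<close>. The order that this library theory puts on the
  type is lexicographic and plays no role here.
\<close>

type_synonym laurent = "int \<Rightarrow>\<^sub>0 int"

definition qpow :: "int \<Rightarrow> laurent" where
  "qpow N = Poly_Mapping.single N 1"

definition U :: "laurent set" where
  "U = {qpow N | N. True} \<union> {- qpow N | N. True}"

definition GL_q :: "(laurent^2^2) monoid" where
  "GL_q = \<lparr>carrier = {M. det M \<in> U}, mult = (**), one = mat 1\<rparr>"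

text \<open>\<^term>\<open>mat u\<close> is the scalar matrix with diagonal entries \<^term>\<open>u\<close>.\<close>

definition scalars_q :: "(laurent^2^2) set" where
  "scalars_q = {mat u | u. u \<in> U}"

definition PGL_q :: "(laurent^2^2) set monoid" where
  "PGL_q = GL_q Mod scalars_q"

definition class_q :: "laurent^2^2 \<Rightarrow> (laurent^2^2) set" where
  "class_q M = scalars_q #>\<^bsub>GL_q\<^esub> M"

definition R_q :: "laurent^2^2" where
  "R_q = vector [vector [qpow 1, 1],
                 vector [0,      1]]"

definition S_q :: "laurent^2^2" where
  "S_q = vector [vector [0, - qpow (- 1)],
                 vector [1, 0]]"

definition PSL_q :: "(laurent^2^2) set monoid" where
  "PSL_q = PGL_q\<lparr>carrier := generate PGL_q {class_q R_q, class_q S_q}\<rparr>"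

definition laurent_eval :: "int poly \<Rightarrow> laurent \<Rightarrow> laurent" where
  "laurent_eval T x = poly (map_poly of_int T) x"

text \<open>
  The exponent \<^term>\<open>n\<close> need not be the degree: palindromicity is about the coefficients between
  the lowest and the highest nonzero one. The zero polynomial is palindromic.
\<close>

definition palindromic :: "int poly \<Rightarrow> bool" where
  "palindromic T \<longleftrightarrow>
     (\<exists>n::int. laurent_eval T (qpow 1) = qpow n * laurent_eval T (qpow (- 1)))"

lemma qpow_0: "qpow 0 = 1"
  by (simp add: qpow_def)

lemma qpow_add: "qpow (m + n) = qpow m * qpow n"
  by (simp add: qpow_def mult_single)

lemma U_iff: "u \<in> U \<longleftrightarrow> (\<exists>N. u = qpow N \<or> u = - qpow N)"
  by (auto simp: U_def)

lemma one_in_U: "1 \<in> U"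
  unfolding U_iff by (metis qpow_0)

lemma mult_in_U: "u \<in> U \<Longrightarrow> v \<in> U \<Longrightarrow> u * v \<in> U"
  unfolding U_iff by (metis minus_mult_left minus_mult_right minus_minus qpow_add)

lemma inverse_in_U:
  assumes "u \<in> U"
  obtains v where "v \<in> U" "u * v = 1" "v * u = 1"
proof -
  obtain N where N: "u = qpow N \<or> u = - qpow N"
    using assms by (auto simp: U_iff)
  have *: "qpow N * qpow (- N) = 1" "qpow (- N) * qpow N = 1"
    by (simp_all add: qpow_0 flip: qpow_add)
  from N show ?thesis
  proof
    assume "u = qpow N"
    with * show ?thesis by (intro that[of "qpow (- N)"]) (auto simp: U_iff)
  next
    assume "u = - qpow N"
    with * show ?thesis by (intro that[of "- qpow (- N)"]) (auto simp: U_iff)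
  qed
qed

lemma group_GL_q: "group GL_q"
proof (rule groupI)
  fix A assume "A \<in> carrier GL_q"
  then have "det A \<in> U" by (simp add: GL_q_def)
  then obtain v where v: "v \<in> U" "det A * v = 1" "v * det A = 1"
    using inverse_in_U by metis
  define B :: "laurent^2^2" where
    "B = vector [vector [v * A$2$2, - (v * A$1$2)], vector [- (v * A$2$1), v * A$1$1]]"
  have "B ** A = mat (v * det A)"
    by (simp add: vec_eq_iff forall_2 matrix_matrix_mult_def sum_2 B_def vector_2 mat_def det_2
        algebra_simps)
  with v have BA: "B ** A = mat 1" by simp
  have "det B = v * (v * det A)"
    by (simp add: B_def vector_2 det_2 algebra_simps)
  with v have "det B \<in> U" by simp
  with BA show "\<exists>B\<in>carrier GL_q. B \<otimes>\<^bsub>GL_q\<^esub> A = \<one>\<^bsub>GL_q\<^esub>"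
    by (auto simp: GL_q_def)
qed (auto simp: GL_q_def det_mul mult_in_U one_in_U matrix_mul_assoc)

lemma det_mat_2: "det (mat u :: laurent^2^2) = u * u"
  by (simp add: det_2 mat_def)

lemma mat_mult_mat: "(mat u :: laurent^2^2) ** mat v = mat (u * v)"
  by (simp add: vec_eq_iff forall_2 matrix_matrix_mult_def sum_2 mat_def)

lemma mat_commute: "(mat u :: laurent^2^2) ** (A :: laurent^2^2) = A ** mat u"
  by (auto simp: vec_eq_iff forall_2 matrix_matrix_mult_def sum_2 mat_def algebra_simps)

lemma normal_scalars_q: "scalars_q \<lhd> GL_q"
proof -
  interpret group GL_q by (rule group_GL_q)
  have sub: "scalars_q \<subseteq> carrier GL_q"
    by (auto simp: scalars_q_def GL_q_def det_mat_2 mult_in_U)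
  have mul: "A \<otimes>\<^bsub>GL_q\<^esub> B \<in> scalars_q" if "A \<in> scalars_q" "B \<in> scalars_q" for A B
    using that by (auto simp: scalars_q_def GL_q_def mat_mult_mat intro: mult_in_U)
  have inv: "inv\<^bsub>GL_q\<^esub> A \<in> scalars_q" if A: "A \<in> scalars_q" for A
  proof -
    obtain u where u: "u \<in> U" "A = mat u" using A by (auto simp: scalars_q_def)
    obtain v where v: "v \<in> U" "v * u = 1" using inverse_in_U[OF u(1)] by metis
    have "mat v \<otimes>\<^bsub>GL_q\<^esub> A = \<one>\<^bsub>GL_q\<^esub>"
      using u v by (simp add: GL_q_def mat_mult_mat)
    moreover have B: "mat v \<in> scalars_q" using v by (auto simp: scalars_q_def)
    ultimately have "inv\<^bsub>GL_q\<^esub> A = mat v"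
      using inv_equality sub A by auto
    with B show ?thesis by simp
  qed
  have "subgroup scalars_q GL_q"
    using sub mul inv one_in_U by (intro subgroupI) (auto simp: scalars_q_def)
  moreover have "scalars_q #>\<^bsub>GL_q\<^esub> A = A <#\<^bsub>GL_q\<^esub> scalars_q" for A
    by (auto simp: r_coset_def l_coset_def scalars_q_def GL_q_def mat_commute)
  ultimately show ?thesis
    by (intro normalI) auto
qed

lemma group_PGL_q: "group PGL_q"
  unfolding PGL_q_def by (rule normal.factorgroup_is_group[OF normal_scalars_q])

lemma det_R_q: "det R_q = qpow 1"
  by (simp add: R_q_def det_2 vector_2)

lemma det_S_q: "det S_q = qpow (- 1)"
  by (simp add: S_q_def det_2 vector_2)

lemma generators_in_PGL_q: "{class_q R_q, class_q S_q} \<subseteq> carrier PGL_q"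
proof -
  have "R_q \<in> carrier GL_q" "S_q \<in> carrier GL_q"
    by (auto simp: GL_q_def det_R_q det_S_q U_iff)
  then show ?thesis
    by (auto simp: class_q_def PGL_q_def FactGroup_def RCOSETS_def)
qed

lemma subgroup_PSL_q: "subgroup (carrier PSL_q) PGL_q"
  using group.generate_is_subgroup[OF group_PGL_q generators_in_PGL_q]
  by (simp add: PSL_q_def)

end

theory Submission
  imports Defs
begin

text \<open>
  Up to scalars, \<open>S_q\<close> has order 2 and \<open>U_q = R_q S_q\<close> has order 3, with inverse \<open>V_q\<close>. As in the
  modular group, every element is therefore an alternating word in \<open>S_q\<close> and \<open>U_q\<close>, \<open>V_q\<close>.
  The products \<open>U_q S_q\<close> and \<open>V_q S_q\<close> are, up to scalars, \<open>R_q\<close> and a lower triangular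
  matrix \<open>L_q\<close>, both with nonnegative coefficients. Cyclic rotation of words preserves the trace,
  so every trace is a unit times the trace of a word in \<open>R_q\<close> and \<open>L_q\<close>, of \<open>S_q\<close>
  (trace 0), or of \<open>U_q\<close> or \<open>V_q\<close> (trace 1).

  Palindromicity comes from a fixed matrix \<open>K\<close> with \<open>det K \<noteq> 0\<close> such that
  \<open>q\<^sup>d M(q\<inverse>) K = K M(q)\<close> for every \<open>M\<close> in the group, where \<open>q\<^sup>d = det M\<close>;
  hence \<open>tr M(q) = q\<^sup>d tr M(q\<inverse>)\<close>.
\<close>

section \<open>The involution q -> q^(-1) on Laurent polynomials\<close>

definition bar :: "laurent \<Rightarrow> laurent" where
  "bar = frag_extend (\<lambda>N. qpow (- N))"

lemma bar_qpow [simp]: "bar (qpow N) = qpow (- N)"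
  by (simp add: bar_def qpow_def)

lemma bar_0 [simp]: "bar 0 = 0"
  by (simp add: bar_def)

lemma bar_1 [simp]: "bar 1 = 1"
  by (metis bar_qpow qpow_0 minus_zero)

lemma bar_minus [simp]: "bar (- p) = - bar p"
  by (simp add: bar_def frag_extend_minus)

lemma bar_add [simp]: "bar (p + r) = bar p + bar r"
  by (simp add: bar_def frag_extend_add)

lemma bar_diff [simp]: "bar (p - r) = bar p - bar r"
  by (simp add: bar_def frag_extend_diff)

text \<open>Laurent polynomials form the free abelian group on the powers of q, so an additive
  identity need only be checked on \<open>qpow N\<close>. Applied to each factor in turn, this gives
  multiplicativity of \<open>bar\<close>.\<close>

lemma laurent_induct [case_names zero qpow diff]:
  assumes "P 0" "\<And>N. P (qpow N)" "\<And>a b. P a \<Longrightarrow> P b \<Longrightarrow> P (a - b)"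
  shows "P (p :: laurent)"
  using frag_induction[of p UNIV P] assms by (simp add: qpow_def)

lemma bar_mult [simp]: "bar (p * r) = bar p * bar r"
proof (induction p rule: laurent_induct)
  case (qpow N)
  show ?case
    by (induction r rule: laurent_induct) (simp_all add: algebra_simps flip: qpow_add)
qed (simp_all add: algebra_simps)

lemma bar_of_int [simp]: "bar (of_int c) = of_int c"
proof -
  have nat: "bar (of_nat n) = of_nat n" for n by (induction n) simp_all
  show ?thesis
  proof (cases c)
    case (nonneg n)
    then show ?thesis by (simp add: nat)
  next
    case (neg n)
    then show ?thesis by (simp only: nat of_int_minus of_int_of_nat_eq bar_minus)
  qed
qed

section \<open>Evaluation of integer polynomials\<close>

lemma laurent_eval_pCons [simp]:
  "laurent_eval (pCons c T) x = of_int c + x * laurent_eval T x"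
  by (simp add: laurent_eval_def map_poly_pCons)

lemma laurent_eval_0 [simp]: "laurent_eval 0 x = 0"
  by (simp add: laurent_eval_def)

lemma laurent_eval_add: "laurent_eval (S + T) x = laurent_eval S x + laurent_eval T x"
proof -
  have "map_poly of_int (S + T) = map_poly of_int S + (map_poly of_int T :: laurent poly)"
    by (rule poly_eqI) (simp add: coeff_map_poly)
  then show ?thesis by (simp add: laurent_eval_def)
qed

lemma qpow_power: "qpow N ^ n = qpow (int n * N)"
  by (induction n) (simp_all add: qpow_0 distrib_right flip: qpow_add)

lemma laurent_eval_monom_mult: "laurent_eval (monom 1 n * T) x = x ^ n * laurent_eval T x"
  by (induction n) (simp_all add: monom_0 monom_Suc mult.assoc)

lemma bar_laurent_eval: "bar (laurent_eval T x) = laurent_eval T (bar x)"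
  by (induction T) simp_all

section \<open>Laurent polynomials with nonnegative coefficients\<close>

text \<open>Powers of q are added one at a time, with repetition, so closure under sums and products
  reduces to treating a single power.\<close>

inductive_set nonneg :: "laurent set" where
  zero: "0 \<in> nonneg"
| step: "p \<in> nonneg \<Longrightarrow> qpow N + p \<in> nonneg"

lemma nonneg_add: "p \<in> nonneg \<Longrightarrow> r \<in> nonneg \<Longrightarrow> p + r \<in> nonneg"
  by (induction p rule: nonneg.induct) (auto simp: add.assoc intro: nonneg.intros)

lemma qpow_nonneg: "qpow N \<in> nonneg"
  using nonneg.step[OF nonneg.zero, of N] by simp

lemma one_nonneg: "1 \<in> nonneg"
  using qpow_nonneg[of 0] by (simp add: qpow_0)

lemma nonneg_mult: "p \<in> nonneg \<Longrightarrow> r \<in> nonneg \<Longrightarrow> p * r \<in> nonneg"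
proof (induction p rule: nonneg.induct)
  case (step p N)
  have "qpow N * r \<in> nonneg" using step.prems
    by (induction r rule: nonneg.induct)
      (auto simp: distrib_left intro: nonneg.intros simp flip: qpow_add)
  then show ?case using step by (simp add: distrib_right nonneg_add)
qed (simp add: nonneg.zero)

lemma nonneg_polynomial:
  assumes "p \<in> nonneg"
  shows "\<exists>N T. (\<forall>i. 0 \<le> coeff T i) \<and> p = qpow N * laurent_eval T (qpow 1)"
  using assms
proof (induction p rule: nonneg.induct)
  case zero
  show ?case by (rule exI[of _ 0], rule exI[of _ 0]) simp
next
  case (step p M)
  then obtain N T where T: "\<forall>i. 0 \<le> coeff T i" "p = qpow N * laurent_eval T (qpow 1)"
    by blast
  \<comment> \<open>Factoring out the smaller shift leaves nonnegative exponents \<open>a\<close>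
    and \<open>b\<close>, so the sum stays an ordinary polynomial times a power of q.\<close>
  define k where "k = min M N"
  define a b where "a = nat (M - k)" and "b = nat (N - k)"
  have ab: "M = k + int a" "N = k + int b"
    by (auto simp: a_def b_def k_def)
  \<comment> \<open>The factor \<open>1\<close> lets \<open>laurent_eval_monom_mult\<close> apply to
    both summands.\<close>
  define T' where "T' = monom 1 a * 1 + monom 1 b * T"
  have "\<forall>i. 0 \<le> coeff T' i"
    using T(1) by (simp add: T'_def coeff_monom_mult)
  moreover have "qpow M + p = qpow k * laurent_eval T' (qpow 1)"
    unfolding T'_def laurent_eval_add laurent_eval_monom_mult
    by (simp add: T(2) ab qpow_add qpow_power distrib_left mult.assoc laurent_eval_def)
  ultimately show ?case by blast
qed

section \<open>Generators and equality up to unit scalars\<close>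

definition L_q :: "laurent^2^2" where
  "L_q = vector [vector [1, 0], vector [1, qpow (- 1)]]"

definition U_q :: "laurent^2^2" where
  "U_q = vector [vector [1, - 1], vector [1, 0]]"

definition V_q :: "laurent^2^2" where
  "V_q = vector [vector [0, 1], vector [- 1, 1]]"

lemmas matrix_2_simps =
  vec_eq_iff forall_2 matrix_matrix_mult_def sum_2 vector_2 mat_def

lemma qpow_cancel [simp]:
  "qpow 1 * qpow (- 1) = 1" "qpow (- 1) * qpow 1 = 1"
  by (simp_all add: qpow_0 flip: qpow_add)

text \<open>Equality in the projective group, kept on matrices so that traces remain available:
  related matrices have traces differing by a unit factor.\<close>

definition scal_eq :: "laurent^2^2 \<Rightarrow> laurent^2^2 \<Rightarrow> bool" (infix "\<approx>" 50) where
  "A \<approx> B \<longleftrightarrow> (\<exists>u\<in>U. A = mat u ** B)"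

lemma scal_eqI: "u \<in> U \<Longrightarrow> A = mat u ** B \<Longrightarrow> A \<approx> B"
  by (auto simp: scal_eq_def)

lemma scal_eq_refl [intro, simp]: "A \<approx> A"
  by (rule scal_eqI[OF one_in_U]) simp

lemma scal_eq_sym:
  assumes "A \<approx> B"
  shows "B \<approx> A"
proof -
  obtain u where u: "u \<in> U" "A = mat u ** B" using assms unfolding scal_eq_def by blast
  obtain v where v: "v \<in> U" "v * u = 1" using inverse_in_U[OF u(1)] by blast
  have "mat v ** A = B"
    by (simp add: u v matrix_mul_assoc mat_mult_mat)
  with v show ?thesis by (intro scal_eqI[of v]) auto
qed

lemma scal_eq_mult:
  assumes "A \<approx> B" "C \<approx> D"
  shows "A ** C \<approx> B ** D"
proof -
  obtain u v where uv: "u \<in> U" "A = mat u ** B" "v \<in> U" "C = mat v ** D"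
    using assms unfolding scal_eq_def by blast
  have "A ** C = mat u ** (B ** mat v) ** D"
    by (simp add: uv matrix_mul_assoc)
  also have "\<dots> = mat (u * v) ** (B ** D)"
    by (simp only: mat_commute[of v B, symmetric] mat_mult_mat[symmetric] matrix_mul_assoc)
  finally show ?thesis using uv mult_in_U by (intro scal_eqI[of "u * v"]) auto
qed

lemma scal_eq_trans [trans]:
  assumes "A \<approx> B" "B \<approx> C"
  shows "A \<approx> C"
proof -
  obtain u v where uv: "u \<in> U" "A = mat u ** B" "v \<in> U" "B = mat v ** C"
    using assms unfolding scal_eq_def by blast
  then show ?thesis
    by (intro scal_eqI[of "u * v"]) (simp_all add: mult_in_U matrix_mul_assoc mat_mult_mat)
qed

lemma trace_mat_mult: "trace (mat u ** (A :: laurent^2^2)) = u * trace A"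
  by (simp add: matrix_2_simps trace_def distrib_left)

lemma units: "- 1 \<in> U" "qpow N \<in> U" "- qpow N \<in> U"
  unfolding U_iff by (metis qpow_0) blast+

lemma S_S: "S_q ** S_q \<approx> mat 1"
  by (rule scal_eqI[OF units(3)[of "- 1"]]) (simp add: S_q_def matrix_2_simps)

lemma U_S: "U_q ** S_q \<approx> R_q"
  by (rule scal_eqI[OF units(3)[of "- 1"]]) (simp add: S_q_def R_q_def U_q_def matrix_2_simps)

lemma R_S: "R_q ** S_q = U_q"
  by (simp add: S_q_def R_q_def U_q_def matrix_2_simps)

lemma V_S: "V_q ** S_q = L_q"
  by (simp add: S_q_def L_q_def V_q_def matrix_2_simps)

lemma U_V: "U_q ** V_q = mat 1" and V_U: "V_q ** U_q = mat 1"
  by (simp_all add: U_q_def V_q_def matrix_2_simps)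

lemma U_U: "U_q ** U_q \<approx> V_q" and V_V: "V_q ** V_q \<approx> U_q"
  by (rule scal_eqI[OF units(1)], simp add: U_q_def V_q_def matrix_2_simps)+

section \<open>Words in \<open>R_q\<close> and \<open>L_q\<close> and their traces\<close>

definition rot :: "bool \<Rightarrow> laurent^2^2" where
  "rot b = (if b then U_q else V_q)"

definition shear :: "bool \<Rightarrow> laurent^2^2" where
  "shear b = (if b then R_q else L_q)"

fun word :: "bool list \<Rightarrow> laurent^2^2" where
  "word [] = mat 1"
| "word (b # w) = shear b ** word w"

lemma rot_S: "rot b ** S_q \<approx> shear b"
  by (simp add: rot_def shear_def U_S V_S)

text \<open>The order-3 relations: \<open>U_q\<close> and \<open>V_q\<close> are mutually inverse,
  and each squares to minus the other.\<close>

lemma rot_rot: "rot b ** rot c \<approx> (if b = c then rot (\<not> b) else mat 1)"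
  by (simp add: rot_def U_U V_V U_V V_U)

lemma word_snoc: "word (w @ [b]) = word w ** shear b"
  by (induction w) (simp_all add: matrix_mul_assoc)

lemma word_nonneg: "word w $ i $ j \<in> nonneg"
proof (induction w arbitrary: i j)
  case Nil
  show ?case by (simp add: mat_def nonneg.zero one_nonneg)
next
  case (Cons b w)
  have "shear b $ i $ k \<in> nonneg" for k
    using exhaust_2[of i] exhaust_2[of k]
    by (auto simp: shear_def R_q_def L_q_def nonneg.zero one_nonneg qpow_nonneg)
  then show ?case
    by (simp add: matrix_matrix_mult_def sum_2 nonneg_add nonneg_mult Cons)
qed

definition pos_trace :: "laurent^2^2 \<Rightarrow> bool" where
  "pos_trace M \<longleftrightarrow> (\<exists>u\<in>U. \<exists>p\<in>nonneg. trace M = u * p)"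

lemma pos_trace_cong: "A \<approx> B \<Longrightarrow> pos_trace A \<longleftrightarrow> pos_trace B"
proof -
  have "pos_trace A" if "A \<approx> B" "pos_trace B" for A B
    using that unfolding pos_trace_def scal_eq_def
    by (metis trace_mat_mult mult.assoc mult_in_U)
  then show "A \<approx> B \<Longrightarrow> pos_trace A \<longleftrightarrow> pos_trace B"
    using scal_eq_sym by blast
qed

lemma pos_trace_commute: "pos_trace (A ** B) \<longleftrightarrow> pos_trace (B ** A)"
  by (simp add: pos_trace_def trace_mul_sym[of A B])

lemma pos_trace_nonneg: "trace M \<in> nonneg \<Longrightarrow> pos_trace M"
  unfolding pos_trace_def using one_in_U by force

lemma pos_trace_word: "pos_trace (word w)"
  by (rule pos_trace_nonneg) (simp add: trace_def sum_2 nonneg_add word_nonneg)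

text \<open>A word followed by \<open>S_q\<close> or by a rotation shortens cyclically through the
  order-2 and order-3 relations. The two claims feed each other, hence the joint induction on
  length.\<close>

lemma pos_trace_word_S_rot:
  "pos_trace (word w ** S_q) \<and> (\<forall>b. pos_trace (word w ** rot b))"
proof (induction "length w" arbitrary: w rule: less_induct)
  case less
  show ?case
  proof (cases w)
    case Nil
    have "trace S_q = 0" "trace (rot b) = 1" for b
      by (simp_all add: trace_def sum_2 S_q_def rot_def U_q_def V_q_def)
    with Nil show ?thesis
      by (auto intro!: pos_trace_nonneg simp: nonneg.zero one_nonneg)
  next
    case (Cons c v)
    have "pos_trace (word w ** S_q)"
    proof -
      obtain v' c' where w: "w = v' @ [c']"
        using Cons by (metis list.discI rev_exhaust)
      \<comment> \<open>The relation \<open>rot_S\<close> is solved for the rotation using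
        \<open>S_S\<close>. The last letter then absorbs \<open>S_q\<close>, which leaves the second
        claim for the shorter \<open>v'\<close>.\<close>
      have "rot c' \<approx> shear c' ** S_q"
      proof -
        have "shear c' ** S_q \<approx> rot c' ** S_q ** S_q"
          by (intro scal_eq_mult scal_eq_sym[OF rot_S]) simp
        also have "\<dots> \<approx> rot c' ** mat 1"
          unfolding matrix_mul_assoc[symmetric] by (intro scal_eq_mult S_S) simp
        finally show ?thesis by (simp add: scal_eq_sym)
      qed
      then have "word v' ** rot c' \<approx> word w ** S_q"
        unfolding w word_snoc matrix_mul_assoc[symmetric] by (intro scal_eq_mult) simp
      with less[of v'] show ?thesis
        using pos_trace_cong by (auto simp: w)
    qed
    moreover have "pos_trace (word w ** rot b)" for b
    proof -
      \<comment> \<open>The first letter is split as \<open>rot c ** S_q\<close>; cycling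
        \<open>rot c\<close> to the end puts the two rotations side by side.\<close>
      have "word w ** rot b \<approx> rot c ** (S_q ** word v ** rot b)"
        unfolding Cons word.simps matrix_mul_assoc
        by (intro scal_eq_mult scal_eq_sym[OF rot_S]) auto
      then have "pos_trace (word w ** rot b) \<longleftrightarrow> pos_trace (S_q ** word v ** rot b ** rot c)"
        using pos_trace_cong pos_trace_commute by blast
      also have "\<dots> \<longleftrightarrow> pos_trace (S_q ** (word v ** (rot b ** rot c)))"
        by (simp add: matrix_mul_assoc)
      also have "\<dots> \<longleftrightarrow> pos_trace (word v ** (rot b ** rot c) ** S_q)"
        by (rule pos_trace_commute)
      also have "\<dots> \<longleftrightarrow> pos_trace (word v ** (if b = c then rot (\<not> b) else mat 1) ** S_q)"
        by (intro pos_trace_cong scal_eq_mult rot_rot) simp_all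
      also have "\<dots>"
      \<comment> \<open>Equal rotations merge into the opposite one, which absorbs the trailing
        \<open>S_q\<close> as a letter; opposite ones cancel and leave the first claim for
        \<open>v\<close>.\<close>
      proof (cases "b = c")
        case True
        have "word v ** rot (\<not> b) ** S_q \<approx> word (v @ [\<not> b])"
          unfolding word_snoc matrix_mul_assoc[symmetric] by (intro scal_eq_mult rot_S) simp
        then show ?thesis using True pos_trace_word pos_trace_cong by simp
      next
        case False
        then show ?thesis using less[of v] Cons by simp
      qed
      finally show ?thesis .
    qed
    ultimately show ?thesis by blast
  qed
qed

section \<open>Products of the generators and their normal form\<close>

text \<open>A monoid suffices to reach the whole group: up to scalars, the inverses of
  \<open>R_q\<close> and \<open>S_q\<close> are again such products
  (\<open>left_inverse_words_q\<close>).\<close>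

inductive_set words_q :: "(laurent^2^2) set" where
  scalar: "u \<in> U \<Longrightarrow> mat u \<in> words_q"
| R: "M \<in> words_q \<Longrightarrow> R_q ** M \<in> words_q"
| S: "M \<in> words_q \<Longrightarrow> S_q ** M \<in> words_q"

lemma words_q_mult: "A \<in> words_q \<Longrightarrow> B \<in> words_q \<Longrightarrow> A ** B \<in> words_q"
proof (induction A rule: words_q.induct)
  case (scalar u)
  \<comment> \<open>The scalar moves through the word \<open>B\<close> to merge with the scalar at
    its end.\<close>
  from scalar(2) show ?case
  proof (induction B rule: words_q.induct)
    case (scalar v)
    then show ?case using \<open>u \<in> U\<close> by (simp add: mat_mult_mat mult_in_U words_q.scalar)
  qed (metis mat_commute matrix_mul_assoc words_q.R words_q.S)+
qed (auto simp: matrix_mul_assoc[symmetric] intro: words_q.R words_q.S)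

text \<open>An alternating word in \<open>S_q\<close> and rotations, grouped into letters of the
  form rotation times \<open>S_q\<close>; \<open>P\<close> is a possible initial \<open>S_q\<close>,
  and \<open>t\<close> a possible final rotation.\<close>

definition normal_form :: "laurent^2^2 \<Rightarrow> bool" where
  "normal_form M \<longleftrightarrow>
     (\<exists>P w t. P \<in> {mat 1, S_q} \<and> t \<in> insert (mat 1) (range rot) \<and> M \<approx> P ** (word w ** t))"

lemma normal_form_cong: "A \<approx> B \<Longrightarrow> normal_form B \<Longrightarrow> normal_form A"
  unfolding normal_form_def using scal_eq_trans by blast

lemma normal_formI:
  "P \<in> {mat 1, S_q} \<Longrightarrow> t \<in> insert (mat 1) (range rot) \<Longrightarrow> M \<approx> P ** (word w ** t)
    \<Longrightarrow> normal_form M"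
  unfolding normal_form_def by blast

lemma normal_form_S:
  assumes "normal_form M"
  shows "normal_form (S_q ** M)"
proof -
  obtain P w t where *: "P \<in> {mat 1, S_q}" "t \<in> insert (mat 1) (range rot)"
    "M \<approx> P ** (word w ** t)"
    using assms unfolding normal_form_def by blast
  have M: "S_q ** M \<approx> S_q ** (P ** (word w ** t))"
    using * by (intro scal_eq_mult) auto
  show ?thesis
  proof (cases "P = S_q")
    case True
    note M
    also have "S_q ** (P ** (word w ** t)) \<approx> mat 1 ** (word w ** t)"
      unfolding True by (subst matrix_mul_assoc) (rule scal_eq_mult[OF S_S scal_eq_refl])
    finally show ?thesis using * by (intro normal_formI[of "mat 1" t _ w]) auto
  next
    case False
    with * M show ?thesis by (intro normal_formI[of S_q]) auto
  qed
qed

text \<open>Only the left end of the alternating word changes: \<open>U_q\<close> starts a new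
  letter before an initial \<open>S_q\<close>, and otherwise meets the first rotation through the
  order-3 relations.\<close>

lemma normal_form_U:
  assumes "normal_form M"
  shows "normal_form (U_q ** M)"
proof -
  obtain P w t where *: "P \<in> {mat 1, S_q}" "t \<in> insert (mat 1) (range rot)"
    "M \<approx> P ** (word w ** t)"
    using assms unfolding normal_form_def by blast
  have "U_q ** M \<approx> U_q ** (P ** (word w ** t))"
    using * by (intro scal_eq_mult) auto
  moreover have "normal_form (U_q ** (P ** (word w ** t)))"
  proof (cases "P = S_q")
    case True
    have "U_q ** (P ** (word w ** t)) \<approx> mat 1 ** (word (True # w) ** t)"
      unfolding True matrix_mul_assoc matrix_mul_lid word.simps shear_def
      by (intro scal_eq_mult) (simp_all add: U_S)
    then show ?thesis using * by (intro normal_formI[of "mat 1" t _ "True # w"]) auto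
  next
    case False
    then have P: "P = mat 1" using * by simp
    show ?thesis
    \<comment> \<open>Without letters, \<open>U_q\<close> combines with the final \<open>t\<close>
      alone; otherwise with the rotation inside the first letter.\<close>
    proof (cases w)
      case Nil
      have "\<exists>t'\<in>insert (mat 1) (range rot). U_q ** t \<approx> t'"
      proof (cases "t = mat 1")
        case True
        then show ?thesis by (auto intro!: bexI[of _ "rot True"] simp: rot_def)
      next
        case False
        then obtain b where "t = rot b" using * by auto
        then have "U_q ** t \<approx> (if b then rot False else mat 1)"
          using rot_rot[of True b] by (auto simp: rot_def split: if_splits)
        then show ?thesis by (auto split: if_splits)
      qed
      then obtain t' where "t' \<in> insert (mat 1) (range rot)" "U_q ** t \<approx> t'" by blast
      then show ?thesis using Nil P by (intro normal_formI[of "mat 1" t' _ "[]"]) auto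
    next
      case (Cons c v)
      have U: "rot True = U_q" by (simp add: rot_def)
      have "shear c ** (word v ** t) \<approx> rot c ** S_q ** (word v ** t)"
        by (rule scal_eq_mult[OF scal_eq_sym[OF rot_S] scal_eq_refl])
      then have "U_q ** (shear c ** (word v ** t)) \<approx> U_q ** (rot c ** S_q ** (word v ** t))"
        by (rule scal_eq_mult[OF scal_eq_refl])
      then have "U_q ** (P ** (word w ** t)) \<approx> rot True ** (rot c ** S_q ** (word v ** t))"
        by (simp add: Cons P U matrix_mul_assoc)
      also have "\<dots> = (rot True ** rot c) ** (S_q ** (word v ** t))"
        by (simp add: matrix_mul_assoc)
      also have "\<dots> \<approx> (if c then rot False else mat 1) ** (S_q ** (word v ** t))"
        using rot_rot[of True c] by (intro scal_eq_mult) auto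
      finally have red: "U_q ** (P ** (word w ** t)) \<approx> \<dots>" .
      show ?thesis
      \<comment> \<open>For \<open>R_q\<close> the two rotations give \<open>V_q\<close> up to sign,
        so the letter becomes \<open>L_q\<close>; for \<open>L_q\<close> they cancel and expose its
        \<open>S_q\<close> as the new prefix.\<close>
      proof (cases c)
        case True
        have "rot False ** (S_q ** (word v ** t)) \<approx> mat 1 ** (word (False # v) ** t)"
          unfolding matrix_mul_assoc matrix_mul_lid word.simps
          by (intro scal_eq_mult rot_S) simp_all
        with red True * show ?thesis
          by (intro normal_formI[of "mat 1" t _ "False # v"]) (auto intro: scal_eq_trans)
      next
        case False
        with red * show ?thesis
          by (intro normal_formI[of S_q t _ v]) auto
      qed
    qed
  qed
  ultimately show ?thesis by (rule normal_form_cong)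
qed

lemma normal_form_words_q: "M \<in> words_q \<Longrightarrow> normal_form M"
proof (induction M rule: words_q.induct)
  case (scalar u)
  then have "mat u \<approx> mat 1" by (auto intro: scal_eqI)
  then show ?case by (intro normal_formI[of "mat 1" "mat 1" _ "[]"]) auto
next
  case (R M)
  have "R_q ** M \<approx> U_q ** S_q ** M"
    by (intro scal_eq_mult scal_eq_sym[OF U_S]) simp
  then show ?case
    using R by (metis normal_form_cong normal_form_U normal_form_S matrix_mul_assoc)
qed (rule normal_form_S)

text \<open>Cycling \<open>P\<close> to the end of the normal form leaves a plain word, a word
  followed by \<open>S_q\<close> or by a rotation, or one whose final rotation and
  \<open>S_q\<close> join into a letter.\<close>

lemma pos_trace_words_q:
  assumes "M \<in> words_q"
  shows "pos_trace M"
proof -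
  obtain P w t where *: "P \<in> {mat 1, S_q}" "t \<in> insert (mat 1) (range rot)"
    "M \<approx> P ** (word w ** t)"
    using normal_form_words_q[OF assms] unfolding normal_form_def by blast
  have "pos_trace (word w ** t ** P)"
  proof -
    consider "P = mat 1" "t = mat 1" | b where "P = mat 1" "t = rot b"
      | "P = S_q" "t = mat 1" | b where "P = S_q" "t = rot b"
      using * by auto
    then show ?thesis
    proof cases
      case (4 b)
      have "word w ** t ** P \<approx> word (w @ [b])"
        unfolding 4 word_snoc matrix_mul_assoc[symmetric] by (intro scal_eq_mult rot_S) simp
      then show ?thesis using pos_trace_word pos_trace_cong by blast
    qed (simp_all add: pos_trace_word pos_trace_word_S_rot)
  qed
  with * show ?thesis using pos_trace_cong pos_trace_commute by blast
qed

section \<open>Symmetry of traces under q -> q^(-1)\<close>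

text \<open>
  \<open>K_q\<close> is, up to scaling, the only matrix satisfying the relation \<open>K_symmetric\<close> below for both
  generators. It is not invertible over the Laurent polynomials, but its determinant is nonzero.
\<close>

definition K_q :: "laurent^2^2" where
  "K_q = vector [vector [1, qpow (- 1) - 1], vector [1 - qpow (- 1), qpow (- 1)]]"

text \<open>The adjugate of \<open>K_q\<close>, standing in for an inverse: both products equal the
  scalar matrix of \<open>K_det\<close>.\<close>

definition K_adj :: "laurent^2^2" where
  "K_adj = vector [vector [qpow (- 1), 1 - qpow (- 1)], vector [qpow (- 1) - 1, 1]]"

definition K_det :: laurent where
  "K_det = 1 - qpow (- 1) + qpow (- 2)"

lemma qpow_2: "qpow (- 1) * qpow (- 1) = qpow (- 2)"
  by (simp flip: qpow_add)

lemma K_q_K_adj: "K_q ** K_adj = mat K_det" "K_adj ** K_q = mat K_det"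
  by (simp_all add: K_q_def K_adj_def K_det_def matrix_2_simps algebra_simps qpow_2)

lemma K_det_nonzero: "K_det \<noteq> 0"
proof
  assume "K_det = 0"
  \<comment> \<open>The coefficients at q^0 differ: it is 1 in \<open>K_det\<close>.\<close>
  then have "Poly_Mapping.lookup K_det 0 = Poly_Mapping.lookup 0 0" by simp
  then show False
    by (simp add: K_det_def qpow_def lookup_add lookup_minus lookup_single lookup_one when_def)
qed

abbreviation mbar :: "laurent^2^2 \<Rightarrow> laurent^2^2" where
  "mbar \<equiv> map_matrix bar"

lemma mbar_mult: "mbar (A ** B) = mbar A ** mbar B"
  by (simp add: matrix_2_simps map_matrix_def)

definition K_symmetric :: "laurent^2^2 \<Rightarrow> bool" where
  "K_symmetric M \<longleftrightarrow> (\<exists>d. mat (qpow d) ** mbar M ** K_q = K_q ** M)"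

text \<open>Intertwining relations compose: \<open>mbar\<close> is multiplicative, scalars commute
  with matrices, and the exponents add.\<close>

lemma K_symmetric_mult:
  assumes "K_symmetric A" "K_symmetric B"
  shows "K_symmetric (A ** B)"
proof -
  obtain a b where
    A: "mat (qpow a) ** mbar A ** K_q = K_q ** A" and
    B: "mat (qpow b) ** mbar B ** K_q = K_q ** B"
    using assms unfolding K_symmetric_def by blast
  have "mat (qpow (a + b)) ** mbar (A ** B) ** K_q
      = mat (qpow a) ** (mat (qpow b) ** mbar A) ** mbar B ** K_q"
    by (simp add: mbar_mult qpow_add mat_mult_mat[symmetric] matrix_mul_assoc)
  also have "\<dots> = mat (qpow a) ** mbar A ** (mat (qpow b) ** mbar B ** K_q)"
    by (simp add: mat_commute[of "qpow b" "mbar A"] matrix_mul_assoc)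
  also have "\<dots> = K_q ** (A ** B)"
    by (simp only: B matrix_mul_assoc A)
  finally show ?thesis unfolding K_symmetric_def by blast
qed

lemma K_symmetric_R: "K_symmetric R_q"
  unfolding K_symmetric_def
  by (rule exI[of _ 1]) (simp add: K_q_def R_q_def matrix_2_simps map_matrix_def algebra_simps)

lemma K_symmetric_S: "K_symmetric S_q"
  unfolding K_symmetric_def
  by (rule exI[of _ "- 1"])
    (simp add: K_q_def S_q_def matrix_2_simps map_matrix_def algebra_simps)

lemma K_symmetric_scalar:
  assumes "u \<in> U"
  shows "K_symmetric (mat u)"
proof -
  obtain N where N: "u = qpow N \<or> u = - qpow N" using assms by (auto simp: U_iff)
  \<comment> \<open>The exponent is that of the determinant of \<open>mat u\<close>, which is q^(2N)
    for either sign.\<close>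
  have "qpow (2 * N) * bar u = u" using N by (auto simp flip: qpow_add)
  moreover have "mbar (mat u) = mat (bar u)"
    by (simp add: matrix_2_simps map_matrix_def)
  ultimately have "mat (qpow (2 * N)) ** mbar (mat u) ** K_q = K_q ** mat u"
    by (simp add: mat_mult_mat mat_commute[of u K_q])
  then show ?thesis unfolding K_symmetric_def by blast
qed

lemma K_symmetric_words_q: "M \<in> words_q \<Longrightarrow> K_symmetric M"
  by (induction M rule: words_q.induct)
    (auto intro: K_symmetric_mult K_symmetric_R K_symmetric_S K_symmetric_scalar)

text \<open>Multiplying the relation by \<open>K_adj\<close> and cycling under the trace gives the
  identity times \<open>K_det\<close>, a nonzero factor that cancels.\<close>

lemma K_symmetric_trace:
  assumes "K_symmetric M"
  shows "\<exists>d. trace M = qpow d * bar (trace M)"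
proof -
  obtain d where d: "mat (qpow d) ** mbar M ** K_q = K_q ** M"
    using assms unfolding K_symmetric_def by blast
  have "K_det * trace M = trace (K_adj ** K_q ** M)"
    by (simp add: K_q_K_adj trace_mat_mult)
  also have "\<dots> = trace (K_adj ** (mat (qpow d) ** mbar M ** K_q))"
    by (simp add: d matrix_mul_assoc)
  also have "\<dots> = trace (mat (qpow d) ** mbar M ** K_q ** K_adj)"
    by (rule trace_mul_sym)
  also have "\<dots> = trace (mat K_det ** (mat (qpow d) ** mbar M))"
    by (simp only: matrix_mul_assoc[symmetric] K_q_K_adj mat_commute[of K_det])
  also have "\<dots> = K_det * (qpow d * bar (trace M))"
    by (simp add: trace_mat_mult) (simp add: trace_def sum_2 map_matrix_def)
  finally show ?thesis using K_det_nonzero by auto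
qed

text \<open>\<open>bar\<close> fixes the sign \<open>c\<close> and inverts the shift q^N, so
  \<open>T\<close> inherits the symmetry with exponent \<open>d - 2 * N\<close>.\<close>

lemma palindromic_trace:
  assumes "trace M = qpow d * bar (trace M)"
    and "trace M = c * (qpow N * laurent_eval T (qpow 1))" and "c = 1 \<or> c = - 1"
  shows "palindromic T"
proof -
  let ?E = "laurent_eval T (qpow 1)" and ?E' = "laurent_eval T (qpow (- 1))"
  have "bar ?E = ?E'" by (simp add: bar_laurent_eval)
  then have "qpow N * ?E = qpow d * (qpow (- N) * ?E')"
    using assms by auto
  then have "qpow (- N) * (qpow N * ?E) = qpow (- N) * (qpow d * (qpow (- N) * ?E'))"
    by simp
  then have "?E = qpow (- N + d - N) * ?E'"
    by (simp add: mult.assoc[symmetric] qpow_0 flip: qpow_add)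
  then show ?thesis unfolding palindromic_def by blast
qed

section \<open>From projective classes to representing matrices\<close>

lemma class_q_mult:
  assumes "A \<in> carrier GL_q" "B \<in> carrier GL_q"
  shows "class_q A \<otimes>\<^bsub>PGL_q\<^esub> class_q B = class_q (A ** B)"
  using normal.rcos_sum[OF normal_scalars_q assms]
  by (simp add: PGL_q_def FactGroup_def class_q_def) (simp add: GL_q_def)

lemma class_q_one: "\<one>\<^bsub>PGL_q\<^esub> = class_q (mat 1)"
  by (simp add: PGL_q_def FactGroup_def class_q_def r_coset_def GL_q_def)

lemma words_q_carrier: "M \<in> words_q \<Longrightarrow> M \<in> carrier GL_q"
proof (induction M rule: words_q.induct)
qed (auto simp: GL_q_def det_mul det_mat_2 det_R_q det_S_q intro: mult_in_U units)

lemma mat_1_words_q: "mat 1 \<in> words_q"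
  by (intro words_q.scalar one_in_U)

lemma R_words_q: "R_q \<in> words_q" and S_words_q: "S_q \<in> words_q"
  using words_q.R[OF mat_1_words_q] words_q.S[OF mat_1_words_q] by simp_all

lemma left_inverse_words_q:
  assumes "A \<in> {R_q, S_q}"
  shows "\<exists>B\<in>words_q. B ** A \<approx> mat 1"
proof (cases "A = S_q")
  case True
  then show ?thesis using S_S S_words_q by blast
next
  case False
  then have A: "A = R_q" using assms by simp
  \<comment> \<open>\<open>R_q ** S_q\<close> is \<open>U_q\<close>, of order 3 up to sign. By
    conjugation \<open>S_q ** R_q\<close> also has cube a scalar, and deleting the last
    \<open>R_q\<close> of that cube gives the witness.\<close>
  let ?B = "S_q ** (R_q ** (S_q ** (R_q ** S_q)))"
  have "?B ** A \<approx> mat 1"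
    unfolding A
    by (rule scal_eqI[OF units(1)])
      (simp add: R_q_def S_q_def matrix_2_simps algebra_simps)
  moreover have "?B \<in> words_q" by (intro words_q.R words_q.S S_words_q)
  ultimately show ?thesis by blast
qed

lemma class_q_cong:
  assumes "A \<approx> B"
  shows "class_q A = class_q B"
proof -
  have "class_q A \<subseteq> class_q B" if "A \<approx> B" for A B
  proof -
    obtain u where u: "u \<in> U" "A = mat u ** B" using \<open>A \<approx> B\<close> unfolding scal_eq_def by blast
    then have "mat v ** A = mat (v * u) ** B" for v
      by (simp add: matrix_mul_assoc mat_mult_mat)
    then show ?thesis
      using u by (auto simp: class_q_def r_coset_def scalars_q_def GL_q_def intro: mult_in_U)
  qed
  then show ?thesis using assms scal_eq_sym by blast
qed

lemma generate_words_q: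
  "g \<in> generate PGL_q {class_q R_q, class_q S_q} \<Longrightarrow> \<exists>M\<in>words_q. g = class_q M"
proof (induction g rule: generate.induct)
  case one
  then show ?case using class_q_one mat_1_words_q by blast
next
  case (incl h)
  then show ?case using R_words_q S_words_q by blast
next
  case (inv h)
  then obtain A where A: "A \<in> {R_q, S_q}" "h = class_q A" by blast
  then obtain B where B: "B \<in> words_q" "B ** A \<approx> mat 1"
    using left_inverse_words_q by blast
  have carr: "A \<in> carrier GL_q" "B \<in> carrier GL_q"
    using A B R_words_q S_words_q words_q_carrier by auto
  have in_PGL: "class_q C \<in> carrier PGL_q" if "C \<in> carrier GL_q" for C
    using that by (auto simp: class_q_def PGL_q_def FactGroup_def RCOSETS_def)
  have "class_q B \<otimes>\<^bsub>PGL_q\<^esub> class_q A = \<one>\<^bsub>PGL_q\<^esub>"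
    using class_q_mult carr class_q_cong[OF B(2)] class_q_one by simp
  then have "inv\<^bsub>PGL_q\<^esub> h = class_q B"
    using group.inv_equality[OF group_PGL_q] in_PGL carr A by simp
  then show ?case using B by blast
next
  case (eng g h)
  then show ?case using class_q_mult words_q_carrier words_q_mult by metis
qed

text \<open>\<open>M\<close> lies in its own coset, so it is a unit scalar times some element of
  \<open>words_q\<close>, which contains the scalars and is closed under products.\<close>

lemma representative_words_q:
  assumes "class_q M \<in> carrier PSL_q"
  shows "M \<in> words_q"
proof -
  obtain A where A: "A \<in> words_q" "class_q M = class_q A"
    using generate_words_q assms by (auto simp: PSL_q_def)
  have "M = mat 1 ** M" "mat 1 \<in> scalars_q" using one_in_U by (auto simp: scalars_q_def)
  then have "M \<in> class_q M" by (auto simp: class_q_def r_coset_def GL_q_def intro!: bexI)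
  then obtain u where "u \<in> U" "M = mat u ** A"
    unfolding A(2) by (auto simp: class_q_def r_coset_def GL_q_def scalars_q_def)
  then show ?thesis using A words_q.scalar words_q_mult by blast
qed

theorem theorem1p4:
  fixes g :: "(laurent^2^2) set" and M :: "laurent^2^2"
  assumes "g \<in> carrier PSL_q"
    and "M \<in> carrier GL_q"
    and "class_q M = g"
  shows "\<exists>(N::int) (T::int poly).
           palindromic T \<and> (\<forall>i. coeff T i \<noteq> 0 \<longrightarrow> coeff T i > 0) \<and>
           (trace M = qpow N * laurent_eval T (qpow 1) \<or>
            trace M = - (qpow N * laurent_eval T (qpow 1)))"
proof -
  have M: "M \<in> words_q" using assms representative_words_q by simp
  obtain u p where u: "u \<in> U" "p \<in> nonneg" "trace M = u * p"
    using pos_trace_words_q[OF M] unfolding pos_trace_def by blast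
  obtain k T where T: "\<forall>i. 0 \<le> coeff T i" "p = qpow k * laurent_eval T (qpow 1)"
    using nonneg_polynomial[OF u(2)] by blast
  \<comment> \<open>The unit splits into a sign and a power of q, and the power joins the shift of
    \<open>p\<close>.\<close>
  obtain n c where c: "u = c * qpow n" "c = 1 \<or> c = - 1"
    using u(1) unfolding U_iff by (metis mult_1 mult_minus1)
  have tr: "trace M = c * (qpow (n + k) * laurent_eval T (qpow 1))"
    by (simp add: u T c(1) qpow_add mult.assoc)
  obtain d where "trace M = qpow d * bar (trace M)"
    using K_symmetric_trace[OF K_symmetric_words_q[OF M]] by blast
  then have "palindromic T" using tr c(2) by (rule palindromic_trace)
  moreover have "\<forall>i. coeff T i \<noteq> 0 \<longrightarrow> coeff T i > 0"
    using T(1) by (metis order_le_less)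
  moreover have "trace M = qpow (n + k) * laurent_eval T (qpow 1) \<or>
      trace M = - (qpow (n + k) * laurent_eval T (qpow 1))"
    using tr c(2) by auto
  ultimately show ?thesis by blast
qed

end
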